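(* Let $K$ be a fixed finite set of integers $\geqslant 2$ with $\{2,3\}\subseteq K$, and let $l$ be the maximal element of $K$. For every $K$-saturated graph $G=(V,E)$ with vertex set $V=[n]$ and every $\mathcal A\in\mathfrak A(G)$, we have, as $n\to\infty$, \[\lvert E\rvert-\sum_{k\in K\setminus\{2\}}\lvert\mathcal A_k\rvert\leqslant\left(\frac{\lfloor l/2\rfloor\lceil l/2\rceil-1}{4\lfloor l/2\rfloor\lceil l/2\rceil}+o(1)\right)n^2=\begin{cases}\left(\frac{l^2-4}{4l^2}+o(1)\right)n^2 & \text{for even }l,\\ \left(\frac{l^2-5}{4l^2-4}+o(1)\right)n^2 & \text{for odd }l,\end{cases}\] where $o(1)$ denotes a quantity depending only on $n$ and $K$ (not on $G$ or $\mathcal A$) which tends to $0$ as $n\to\infty$.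
   Context: Let $[n]=\{1,\dots,n\}$, with $n$ large enough that $K\subseteq[n]$. A family $\mathcal A\subseteq 2^{[n]}$ is an antichain if $A\not\subseteq B$ for all distinct $A,B\in\mathcal A$. It is a $K$-antichain if moreover $|A|\in K$ for all $A\in\mathcal A$; then $\mathcal A_k$ denotes the set of members of $\mathcal A$ of size $k$. A $K$-antichain $\mathcal A$ is a maximal $K$-antichain if there is no $K$-antichain $\mathcal A'\subseteq 2^{[n]}$ with $\mathcal A\subsetneq\mathcal A'$. Graphs are finite and simple; a $k$-clique is a set of $k$ pairwise adjacent vertices. A graph is $K$-saturated if every edge is contained in a $k$-clique for some $k\in K\setminus\{2\}$. For a $K$-antichain $\mathcal A$, the associated graph $G(\mathcal A)$ has vertex set $[n]$ and edge set $\binom{[n]}{2}\setminus\mathcal A_2$. For a $K$-saturated graph $G$ on $[n]$, $\mathfrak A(G)$ is the set of all maximal $K$-antichains $\mathcal A$ on $[n]$ with $G(\mathcal A)=G$. *)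

theory Defs
  imports Complex_Main "HOL-Library.Ramsey"
begin

(* A graph is a pair of a vertex set and a set of two-element edges. The sets [X]^k (nsets)
   and the predicate clique, which says that the members of a set are pairwise adjacent but
   does not restrict them to a vertex set, are taken from the theory Ramsey. *)

type_synonym graph = "nat set \<times> nat set set"

definition simple_graph :: "graph \<Rightarrow> bool" where
  "simple_graph G \<longleftrightarrow> finite (fst G) \<and> snd G \<subseteq> [fst G]\<^bsup>2\<^esup>"

definition k_clique :: "nat \<Rightarrow> graph \<Rightarrow> nat set \<Rightarrow> bool" where
  "k_clique k G C \<longleftrightarrow> C \<in> [fst G]\<^bsup>k\<^esup> \<and> clique C (snd G)"

definition saturated :: "nat set \<Rightarrow> graph \<Rightarrow> bool" where
  "saturated K G \<longleftrightarrow> (\<forall>e\<in>snd G. \<exists>k\<in>K - {2}. \<exists>C. k_clique k G C \<and> e \<subseteq> C)"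

definition antichain :: "nat \<Rightarrow> nat set set \<Rightarrow> bool" where
  "antichain n \<A> \<longleftrightarrow> \<A> \<subseteq> Pow {1..n} \<and> (\<forall>A\<in>\<A>. \<forall>B\<in>\<A>. A \<noteq> B \<longrightarrow> \<not> A \<subseteq> B)"

definition K_antichain :: "nat set \<Rightarrow> nat \<Rightarrow> nat set set \<Rightarrow> bool" where
  "K_antichain K n \<A> \<longleftrightarrow> antichain n \<A> \<and> (\<forall>A\<in>\<A>. card A \<in> K)"

definition maximal_K_antichain :: "nat set \<Rightarrow> nat \<Rightarrow> nat set set \<Rightarrow> bool" where
  "maximal_K_antichain K n \<A> \<longleftrightarrow>
     K_antichain K n \<A> \<and> \<not> (\<exists>\<A>'. K_antichain K n \<A>' \<and> \<A> \<subset> \<A>')"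

definition level :: "nat set set \<Rightarrow> nat \<Rightarrow> nat set set" where
  "level \<A> k = {A \<in> \<A>. card A = k}"

definition assoc_graph :: "nat \<Rightarrow> nat set set \<Rightarrow> graph" where
  "assoc_graph n \<A> = ({1..n}, [{1..n}]\<^bsup>2\<^esup> - level \<A> 2)"

definition antichains_of_graph :: "nat set \<Rightarrow> nat \<Rightarrow> graph \<Rightarrow> nat set set set" where
  "antichains_of_graph K n G = {\<A>. maximal_K_antichain K n \<A> \<and> assoc_graph n \<A> = G}"

end

theory Submission
  imports Defs
begin

text \<open>
  By maximality every edge and every triangle of \<open>G\<close> lies in a member of \<open>\<A>\<close> of size at least
  \<open>3\<close>. Let \<open>N\<close> be the number of these members; we may assume \<open>N \<le> |E|\<close>, so \<open>G\<close> has only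
  \<open>O(n\<^sup>2)\<close> triangles and all but \<open>o(n\<^sup>2)\<close> edges are light, that is, lie in at most \<open>\<omega> = sqrt n\<close>
  triangles. No removal lemma is needed: in the graph of light edges the neighbourhoods of the
  vertices of an edge or a triangle are almost disjoint, so with \<open>M = n + 3 \<omega>\<close> and
  \<open>w v = deg v / M\<close> each edge and each triangle has weight at most \<open>1\<close>. Let \<open>m = l\<^sup>2 div 4\<close>, the
  maximal number of edges of a triangle-free graph on \<open>l\<close> vertices. If \<open>F\<close> is a set of light edges
  inside one member, then removing triangles from \<open>F\<close> until at most \<open>m\<close> edges are left gives
  \<open>|F| - 1 \<le> (1 - 1/m) * (\<Sum>e\<in>F. 2 - w e)\<close>. Assign each light edge to one member containing it
  and sum over the members; since \<open>\<Sum>e. w e = (\<Sum>v. (deg v)\<^sup>2) / M\<close>, the sum of \<open>2 - w e\<close> over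
  all light edges is at most \<open>n M / 4\<close>.
\<close>

section \<open>Degrees, sums over edges and Mantel's theorem\<close>

definition nbrs :: "'a set set \<Rightarrow> 'a \<Rightarrow> 'a set" where
  "nbrs E v = {u. {v, u} \<in> E}"

lemma nbrs_subset: "E \<subseteq> [V]\<^bsup>2\<^esup> \<Longrightarrow> nbrs E v \<subseteq> V"
  by (auto simp: nbrs_def nsets_def)

lemma edgeE:
  assumes "E \<subseteq> [V]\<^bsup>2\<^esup>" "e \<in> E"
  obtains u v where "e = {u, v}" "u \<noteq> v" "u \<in> V" "v \<in> V"
  using assms by (auto simp: nsets_def card_2_iff subset_iff)

lemma finite_edges: "finite V \<Longrightarrow> E \<subseteq> [V]\<^bsup>2\<^esup> \<Longrightarrow> finite E"
  by (rule finite_subset[OF _ finite_imp_finite_nsets])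

lemma card_incident_edges:
  assumes "E \<subseteq> [V]\<^bsup>2\<^esup>"
  shows "card {e \<in> E. v \<in> e} = card (nbrs E v)"
proof -
  have "{e \<in> E. v \<in> e} = (\<lambda>u. {v, u}) ` nbrs E v"
  proof
    show "{e \<in> E. v \<in> e} \<subseteq> (\<lambda>u. {v, u}) ` nbrs E v"
    proof
      fix e assume "e \<in> {e \<in> E. v \<in> e}"
      then have e: "e \<in> E" "v \<in> e" by auto
      obtain x y where "e = {x, y}" using edgeE[OF assms e(1)] .
      with e show "e \<in> (\<lambda>u. {v, u}) ` nbrs E v"
        by (auto simp: nbrs_def image_iff insert_commute)
    qed
  qed (auto simp: nbrs_def)
  moreover have "inj_on (\<lambda>u. {v, u}) (nbrs E v)"
    by (auto simp: inj_on_def doubleton_eq_iff)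
  ultimately show ?thesis by (simp add: card_image)
qed

text \<open>Double counting of incident pairs. A constant \<open>g\<close> yields the handshake
  lemma, the degree as \<open>g\<close> yields the sum of squared degrees.\<close>

lemma sum_over_edges:
  fixes g :: "'a \<Rightarrow> real"
  assumes "finite V" "E \<subseteq> [V]\<^bsup>2\<^esup>"
  shows "(\<Sum>e\<in>E. \<Sum>v\<in>e. g v) = (\<Sum>v\<in>V. real (card (nbrs E v)) * g v)"
proof -
  have fE: "finite E" using assms by (rule finite_edges)
  have "(\<Sum>e\<in>E. \<Sum>v\<in>e. g v) = (\<Sum>e\<in>E. \<Sum>v | v \<in> V \<and> v \<in> e. g v)"
    using assms(2) by (intro sum.cong) (auto simp: nsets_def)
  also have "\<dots> = (\<Sum>v\<in>V. \<Sum>e | e \<in> E \<and> v \<in> e. g v)"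
    by (rule sum.swap_restrict[OF fE assms(1)])
  also have "\<dots> = (\<Sum>v\<in>V. real (card (nbrs E v)) * g v)"
    using card_incident_edges[OF assms(2)] by simp
  finally show ?thesis .
qed

text \<open>Summing \<open>(deg v - c/2)\<^sup>2 \<ge> 0\<close>; the choice of \<open>c\<close> replaces an appeal to
  the Cauchy--Schwarz inequality.\<close>

lemma sum_degrees_over_edges_ge:
  fixes c :: real
  assumes "finite V" "E \<subseteq> [V]\<^bsup>2\<^esup>"
  shows "2 * c * card E - card V * c\<^sup>2 / 4 \<le> (\<Sum>e\<in>E. \<Sum>v\<in>e. real (card (nbrs E v)))"
proof -
  let ?d = "\<lambda>v. real (card (nbrs E v))"
  have "(\<Sum>v\<in>V. ?d v * 1) = (\<Sum>e\<in>E. \<Sum>v\<in>e. 1)"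
    using sum_over_edges[OF assms, of "\<lambda>_. 1"] by simp
  also have "\<dots> = (\<Sum>e\<in>E. 2)"
    using assms(2) by (intro sum.cong) (auto simp: nsets_def)
  finally have handshake: "(\<Sum>v\<in>V. ?d v) = 2 * card E" by simp
  have "0 \<le> (\<Sum>v\<in>V. (?d v - c / 2)\<^sup>2)" by (intro sum_nonneg) simp
  also have "\<dots> = (\<Sum>v\<in>V. ?d v * ?d v - c * ?d v + c\<^sup>2 / 4)"
    by (intro sum.cong) (auto simp: power2_eq_square algebra_simps)
  also have "\<dots> = (\<Sum>v\<in>V. ?d v * ?d v) - c * (\<Sum>v\<in>V. ?d v) + card V * c\<^sup>2 / 4"
    by (simp add: sum.distrib sum_subtractf sum_distrib_left)
  finally show ?thesis
    unfolding handshake sum_over_edges[OF assms] by (simp add: algebra_simps)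
qed

text \<open>Without triangles the endpoints of an edge have disjoint neighbourhoods, so their
  degrees add up to at most \<open>card V\<close>; the degree inequality with
  \<open>c = card V\<close> then bounds the number of edges.\<close>

lemma mantel:
  assumes "finite V" "E \<subseteq> [V]\<^bsup>2\<^esup>"
    and triangle_free: "\<And>x y z. {x, y} \<in> E \<Longrightarrow> {x, z} \<in> E \<Longrightarrow> {y, z} \<in> E \<Longrightarrow> False"
  shows "4 * card E \<le> (card V)\<^sup>2"
proof (cases "E = {}")
  case False
  let ?n = "real (card V)"
  obtain v where "v \<in> V" using False edgeE[OF assms(2)] by (metis ex_in_conv)
  then have n: "?n > 0" using assms(1) by (auto simp: card_gt_0_iff)
  have "(\<Sum>v\<in>e. real (card (nbrs E v))) \<le> ?n" if eE: "e \<in> E" for e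
  proof -
    obtain u v where e: "e = {u, v}" "u \<noteq> v" using edgeE[OF assms(2) eE] .
    have sub: "nbrs E u \<subseteq> V" "nbrs E v \<subseteq> V" using nbrs_subset[OF assms(2)] by auto
    have "nbrs E u \<inter> nbrs E v = {}"
      using triangle_free[of u v] eE e by (auto simp: nbrs_def)
    then have "card (nbrs E u) + card (nbrs E v) = card (nbrs E u \<union> nbrs E v)"
      using sub assms(1) by (metis card_Un_disjoint finite_subset)
    also have "\<dots> \<le> card V" using sub assms(1) by (intro card_mono) auto
    finally show ?thesis using e by simp
  qed
  then have "(\<Sum>e\<in>E. \<Sum>v\<in>e. real (card (nbrs E v))) \<le> card E * ?n"
    by (intro sum_bounded_above) simp
  with sum_degrees_over_edges_ge[OF assms(1,2), of ?n]
  have "?n * (4 * card E) \<le> ?n * ?n\<^sup>2"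
    by (simp add: power2_eq_square algebra_simps)
  with n have "real (4 * card E) \<le> real ((card V)\<^sup>2)" by simp
  then show ?thesis by (simp only: of_nat_le_iff)
qed simp

section \<open>Edge deficits inside one member\<close>

lemma two_le_square_div_4: "3 \<le> l \<Longrightarrow> 2 \<le> (l::nat)\<^sup>2 div 4"
  using power_mono[of 3 l 2] by (auto simp: less_eq_div_iff_mult_less_eq)

text \<open>Induction on the number of edges. Up to \<open>l\<^sup>2 div 4\<close> edges the left
  side is not positive and the right side not negative. Beyond that Mantel's theorem provides a
  triangle; deleting its edges takes 3 from the left side and at least
  \<open>l\<^sup>2 div 4 - 1\<close> from the right side, which suffices once
  \<open>l \<ge> 4\<close>.\<close>

lemma total_deficit_ge:
  fixes w :: "'a \<Rightarrow> real"
  assumes "finite V" "card V \<le> l" "3 \<le> l" "F \<subseteq> [V]\<^bsup>2\<^esup>"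
    and edge: "\<And>e. e \<in> F \<Longrightarrow> sum w e \<le> 1"
    and triangle: "\<And>x y z. {x, y} \<in> F \<Longrightarrow> {x, z} \<in> F \<Longrightarrow> {y, z} \<in> F \<Longrightarrow> w x + w y + w z \<le> 1"
  shows "real (card F) - real (l\<^sup>2 div 4) \<le> (real (l\<^sup>2 div 4) - 1) * (\<Sum>e\<in>F. 1 - sum w e)"
  using assms(4) edge triangle
proof (induction "card F" arbitrary: F rule: less_induct)
  case less
  let ?m = "l\<^sup>2 div 4"
  let ?D = "\<lambda>F. \<Sum>e\<in>F. 1 - sum w e"
  have fF: "finite F" using assms(1) less.prems(1) by (rule finite_edges)
  have m2: "2 \<le> ?m" using assms(3) by (rule two_le_square_div_4)
  have D_nonneg: "0 \<le> ?D F'" if "F' \<subseteq> F" for F'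
    using that less.prems(2) by (intro sum_nonneg) auto
  show ?case
  proof (cases "card F \<le> ?m")
    case True
    then have "real (card F) - ?m \<le> 0" by simp
    also have "0 \<le> (real ?m - 1) * ?D F" using m2 D_nonneg[of F] by simp
    finally show ?thesis .
  next
    case False
    then have "l\<^sup>2 < 4 * card F" by linarith
    moreover have "(card V)\<^sup>2 \<le> l\<^sup>2" using assms(2) by (simp add: power_mono)
    ultimately obtain x y z where xyz: "{x, y} \<in> F" "{x, z} \<in> F" "{y, z} \<in> F"
      using mantel[OF assms(1) less.prems(1)] by (metis leD le_trans)
    then have ne: "x \<noteq> y" "x \<noteq> z" "y \<noteq> z" using less.prems(1) by (auto simp: nsets_def)
    let ?T = "{{x, y}, {x, z}, {y, z}}"
    let ?F = "F - ?T"
    have T: "?T \<subseteq> F" "card ?T = 3" using xyz ne by (auto simp: doubleton_eq_iff)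
    have card: "card F = card ?F + 3"
      using T fF card_Diff_subset[of ?T F] card_mono[of F ?T] by simp
    \<comment> \<open>Each vertex of the triangle lies on two of its three edges.\<close>
    have "?D ?T = 3 - 2 * (w x + w y + w z)" using ne by (simp add: doubleton_eq_iff)
    then have "1 \<le> ?D ?T" using less.prems(3)[OF xyz] by simp
    moreover have "?D F = ?D ?F + ?D ?T" by (rule sum.subset_diff[OF T(1) fF])
    ultimately have D: "?D ?F + 1 \<le> ?D F" by simp
    have IH: "real (card ?F) - ?m \<le> (real ?m - 1) * ?D ?F"
      using card less.prems by (intro less.hyps) auto
    have "(real ?m - 1) * (?D ?F + 1) \<le> (real ?m - 1) * ?D F"
      using D m2 by (intro mult_left_mono) auto
    moreover have "real (card F) - ?m \<le> (real ?m - 1) * (?D ?F + 1)"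
    \<comment> \<open>For \<open>l = 3\<close> the factor \<open>?m - 1\<close> is only 1, too small
      to pay for three deleted edges; but then \<open>F\<close> itself has at most three edges and
      the left side is at most 1.\<close>
    proof (cases "l = 3")
      case True
      have "card F \<le> card ([V]\<^bsup>2\<^esup>)"
        using less.prems(1) assms(1) by (intro card_mono finite_imp_finite_nsets)
      also have "\<dots> \<le> 3 choose 2"
        using assms(2) True by (simp add: card_nsets binomial_right_mono)
      finally have "card F \<le> 3" by (simp add: choose_two)
      then show ?thesis using True D_nonneg[of ?F] by (simp add: power2_eq_square)
    next
      case False
      then have "4 \<le> ?m"
        using power_mono[of 4 l 2] assms(3) by (auto simp: less_eq_div_iff_mult_less_eq)
      then show ?thesis using IH card by (simp add: algebra_simps)
    qed
    ultimately show ?thesis by linarith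
  qed
qed

section \<open>Codegrees, light and heavy edges\<close>

text \<open>Triangles are encoded by an edge together with a common neighbour of its endpoints.\<close>

lemma sum_codegree_le:
  fixes V :: "'a set"
  assumes "finite V" "E \<subseteq> [V]\<^bsup>2\<^esup>" "finite \<F>"
    and members: "\<And>B. B \<in> \<F> \<Longrightarrow> finite B \<and> card B \<le> l"
    and covers: "\<And>x y z. {x, y} \<in> E \<Longrightarrow> {x, z} \<in> E \<Longrightarrow> {y, z} \<in> E \<Longrightarrow> \<exists>B\<in>\<F>. {x, y, z} \<subseteq> B"
  shows "(\<Sum>e\<in>E. card (\<Inter>v\<in>e. nbrs E v)) \<le> l ^ 3 * card \<F>"
proof -
  have fin: "finite (\<Inter>v\<in>e. nbrs E v)" if "e \<in> E" for e
    using edgeE[OF assms(2) that] nbrs_subset[OF assms(2)] assms(1)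
    by (metis INF_lower finite_subset insertI1)
  have "(\<Sum>e\<in>E. card (\<Inter>v\<in>e. nbrs E v)) = card (SIGMA e:E. \<Inter>v\<in>e. nbrs E v)"
    using fin finite_edges[OF assms(1,2)] by simp
  also have "\<dots> \<le> card (\<Union>B\<in>\<F>. [B]\<^bsup>2\<^esup> \<times> B)"
  proof (rule card_mono)
    show "finite (\<Union>B\<in>\<F>. [B]\<^bsup>2\<^esup> \<times> B)"
      using assms(3) members by (auto intro: finite_imp_finite_nsets)
    show "(SIGMA e:E. \<Inter>v\<in>e. nbrs E v) \<subseteq> (\<Union>B\<in>\<F>. [B]\<^bsup>2\<^esup> \<times> B)"
    proof clarify
      fix e z assume e: "e \<in> E" and z: "z \<in> (\<Inter>v\<in>e. nbrs E v)"
      obtain x y where xy: "e = {x, y}" "x \<noteq> y" using edgeE[OF assms(2) e] .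
      then obtain B where "B \<in> \<F>" "{x, y, z} \<subseteq> B"
        using covers[of x y z] e z by (auto simp: nbrs_def)
      then show "(e, z) \<in> (\<Union>B\<in>\<F>. [B]\<^bsup>2\<^esup> \<times> B)"
        using xy by (auto simp: nsets_def)
    qed
  qed
  also have "\<dots> \<le> (\<Sum>B\<in>\<F>. card ([B]\<^bsup>2\<^esup> \<times> B))" by (rule card_UN_le[OF assms(3)])
  also have "\<dots> \<le> (\<Sum>B\<in>\<F>. l ^ 3)"
  proof (rule sum_mono)
    fix B assume "B \<in> \<F>"
    then have B: "finite B" "card B \<le> l" using members by auto
    have "card B choose 2 \<le> (card B)\<^sup>2"
      by (cases "2 \<le> card B") (auto intro: binomial_le_pow simp: binomial_eq_0)
    also have "\<dots> \<le> l\<^sup>2" using B by (simp add: power_mono)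
    finally have "(card B choose 2) * card B \<le> l\<^sup>2 * l" using B(2) by (rule mult_le_mono)
    then show "card ([B]\<^bsup>2\<^esup> \<times> B) \<le> l ^ 3"
      by (simp add: card_cartesian_product card_nsets power2_eq_square power3_eq_cube)
  qed
  finally show ?thesis by (simp add: mult.commute)
qed

text \<open>Inclusion-exclusion with the triple intersection dropped. Taking \<open>C = {}\<close>
  gives the version for two sets that serves single edges.\<close>

lemma card_triple_le:
  assumes "finite U" "A \<union> B \<union> C \<subseteq> U"
  shows "card A + card B + card C \<le> card U + card (A \<inter> B) + card (A \<inter> C) + card (B \<inter> C)"
proof -
  have fin: "finite A" "finite B" "finite C" using assms by (auto intro: finite_subset)
  have "card A + card B = card (A \<union> B) + card (A \<inter> B)" using fin by (intro card_Un_Int)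
  moreover have "card (A \<union> B) + card C = card (A \<union> B \<union> C) + card ((A \<union> B) \<inter> C)"
    using fin by (intro card_Un_Int) auto
  moreover have "card ((A \<union> B) \<inter> C) \<le> card (A \<inter> C) + card (B \<inter> C)"
    unfolding Int_Un_distrib2 by (rule card_Un_le)
  moreover have "card (A \<union> B \<union> C) \<le> card U" using assms by (rule card_mono)
  ultimately show ?thesis by linarith
qed

lemma edges_minus_cover_le_light:
  fixes V :: "'a set" and \<omega> :: real
  assumes "finite V" "E \<subseteq> [V]\<^bsup>2\<^esup>" "finite \<F>" "3 \<le> l" "0 < \<omega>"
    and members: "\<And>B. B \<in> \<F> \<Longrightarrow> finite B \<and> card B \<le> l"
    and covers: "\<And>e. e \<in> E \<Longrightarrow> \<exists>B\<in>\<F>. e \<subseteq> B"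
    and light: "\<And>u v. {u, v} \<in> E \<Longrightarrow> card (nbrs E u \<inter> nbrs E v) \<le> \<omega>"
  shows "real (card E) - card \<F>
    \<le> (1 - 1 / real (l\<^sup>2 div 4)) * (card V * (card V + 3 * \<omega>) / 4)"
proof -
  let ?m = "real (l\<^sup>2 div 4)"
  \<comment> \<open>The slack \<open>3 * \<omega>\<close> pays for the three pairwise intersections
    of the neighbourhoods of a triangle.\<close>
  define M where "M = card V + 3 * \<omega>"
  define w where "w v = card (nbrs E v) / M" for v
  have M: "0 < M" using assms(5) by (simp add: M_def)
  have "2 \<le> l\<^sup>2 div 4" using assms(4) by (rule two_le_square_div_4)
  then have m2: "2 \<le> ?m" by linarith
  have fE: "finite E" using assms(1,2) by (rule finite_edges)
  have nV: "nbrs E v \<subseteq> V" for v using nbrs_subset[OF assms(2)] .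
  have triple: "w x + w y + w z \<le> 1"
    if "{x, y} \<in> E" "{x, z} \<in> E" "{y, z} \<in> E" for x y z
  proof -
    have "card (nbrs E x) + card (nbrs E y) + card (nbrs E z) \<le> card V
      + card (nbrs E x \<inter> nbrs E y) + card (nbrs E x \<inter> nbrs E z) + card (nbrs E y \<inter> nbrs E z)"
      using nV by (intro card_triple_le[OF assms(1)]) auto
    then have "real (card (nbrs E x)) + card (nbrs E y) + card (nbrs E z) \<le> M"
      using light[OF that(1)] light[OF that(2)] light[OF that(3)] by (simp add: M_def)
    then show ?thesis using M by (simp add: w_def field_simps)
  qed
  have pair: "sum w e \<le> 1" if eE: "e \<in> E" for e
  proof -
    obtain x y where e: "e = {x, y}" "x \<noteq> y" using edgeE[OF assms(2) eE] .
    have "card (nbrs E x) + card (nbrs E y) \<le> card V + card (nbrs E x \<inter> nbrs E y)"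
      using card_triple_le[OF assms(1), of "nbrs E x" "nbrs E y" "{}"] nV by simp
    then have "real (card (nbrs E x)) + card (nbrs E y) \<le> M"
      using light[of x y] eE e assms(5) by (simp add: M_def)
    then show ?thesis using M e by (simp add: w_def field_simps)
  qed
  \<comment> \<open>Choosing one member per edge partitions \<open>E\<close>, so an edge inside
    several members is counted once.\<close>
  obtain cov where cov: "\<And>e. e \<in> E \<Longrightarrow> cov e \<in> \<F> \<and> e \<subseteq> cov e" using covers by metis
  have local: "real (card {e \<in> E. cov e = B}) - 1
      \<le> (1 - 1 / ?m) * (\<Sum>e | e \<in> E \<and> cov e = B. 2 - sum w e)" if "B \<in> \<F>" for B
  proof -
    let ?F = "{e \<in> E. cov e = B}"
    let ?D = "\<Sum>e\<in>?F. 1 - sum w e"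
    have "?F \<subseteq> [B]\<^bsup>2\<^esup>" using cov assms(2) by (auto simp: nsets_def)
    then have "card ?F - ?m \<le> (?m - 1) * ?D"
      using members[OF that] assms(4) pair triple by (intro total_deficit_ge) auto
    moreover have "(\<Sum>e\<in>?F. 2 - sum w e) = (\<Sum>e\<in>?F. 1 + (1 - sum w e))" by simp
    then have "(\<Sum>e\<in>?F. 2 - sum w e) = card ?F + ?D" by (simp only: sum.distrib) simp
    \<comment> \<open>Add \<open>(?m - 1) * card ?F\<close> to both sides of the deficit bound and
      divide by \<open>?m\<close>.\<close>
    ultimately show ?thesis using m2 by (simp add: field_simps)
  qed
  have "real (card E) - card \<F> = (\<Sum>B\<in>\<F>. \<Sum>e | e \<in> E \<and> cov e = B. 1) - (\<Sum>B\<in>\<F>. 1)"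
    using cov by (subst sum.group[OF fE assms(3)]) auto
  also have "\<dots> = (\<Sum>B\<in>\<F>. real (card {e \<in> E. cov e = B}) - 1)"
    by (simp add: sum_subtractf)
  also have "\<dots> \<le> (\<Sum>B\<in>\<F>. (1 - 1 / ?m) * (\<Sum>e | e \<in> E \<and> cov e = B. 2 - sum w e))"
    by (intro sum_mono local)
  also have "\<dots> = (1 - 1 / ?m) * (\<Sum>e\<in>E. 2 - sum w e)"
    unfolding sum_distrib_left[symmetric]
    using cov by (subst sum.group[OF fE assms(3)]) auto
  also have "\<dots> \<le> (1 - 1 / ?m) * (card V * M / 4)"
  proof (rule mult_left_mono)
    let ?S = "\<Sum>e\<in>E. \<Sum>v\<in>e. real (card (nbrs E v))"
    have "(\<Sum>e\<in>E. 2 - sum w e) = 2 * card E - ?S / M"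
      by (simp add: sum_subtractf w_def sum_divide_distrib)
    \<comment> \<open>The choice \<open>c = M\<close> makes the term \<open>2 * card E\<close>
      cancel exactly.\<close>
    moreover have "2 * card E - card V * M / 4 \<le> ?S / M"
      using sum_degrees_over_edges_ge[OF assms(1,2), of M] M
      by (simp add: field_simps power2_eq_square)
    ultimately show "(\<Sum>e\<in>E. 2 - sum w e) \<le> card V * M / 4" by linarith
  qed (use m2 in simp)
  finally show ?thesis unfolding M_def .
qed

text \<open>Markov's inequality: the codegrees sum to at most \<open>l ^ 3 * card \<F>\<close>, so
  at most \<open>l ^ 3 * card \<F> / \<omega>\<close> edges are heavy. The light edges are still
  covered by \<open>\<F>\<close>, and the previous bound applies to them.\<close>

lemma edges_minus_cover_le:
  fixes V :: "'a set" and \<omega> :: real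
  assumes "finite V" "E \<subseteq> [V]\<^bsup>2\<^esup>" "finite \<F>" "3 \<le> l" "0 < \<omega>"
    and members: "\<And>B. B \<in> \<F> \<Longrightarrow> finite B \<and> card B \<le> l"
    and covers: "\<And>e. e \<in> E \<Longrightarrow> \<exists>B\<in>\<F>. e \<subseteq> B"
    and covers3: "\<And>x y z. {x, y} \<in> E \<Longrightarrow> {x, z} \<in> E \<Longrightarrow> {y, z} \<in> E \<Longrightarrow> \<exists>B\<in>\<F>. {x, y, z} \<subseteq> B"
  shows "real (card E) - card \<F>
    \<le> (1 - 1 / real (l\<^sup>2 div 4)) * (card V * (card V + 3 * \<omega>) / 4) + real l ^ 3 * card \<F> / \<omega>"
proof -
  define c where "c e = card (\<Inter>v\<in>e. nbrs E v)" for e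
  define L where "L = {e \<in> E. c e \<le> \<omega>}"
  have fE: "finite E" using assms(1,2) by (rule finite_edges)
  have "L \<subseteq> E" by (auto simp: L_def)
  have heavy: "card (E - L) * \<omega> \<le> real l ^ 3 * card \<F>"
  proof -
    have "card (E - L) * \<omega> \<le> (\<Sum>e\<in>E - L. real (c e))"
      by (rule sum_bounded_below) (auto simp: L_def)
    also have "\<dots> \<le> (\<Sum>e\<in>E. real (c e))" using fE by (intro sum_mono2) auto
    also have "\<dots> = real (\<Sum>e\<in>E. c e)" by simp
    also have "\<dots> \<le> real (l ^ 3 * card \<F>)"
      unfolding c_def of_nat_le_iff using assms(1-3) members covers3 by (rule sum_codegree_le)
    finally show ?thesis by simp
  qed
  \<comment> \<open>Lightness is measured in \<open>E\<close>; passing to the subgraph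
    \<open>L\<close> can only shrink common neighbourhoods.\<close>
  have "card (nbrs L u \<inter> nbrs L v) \<le> \<omega>" if "{u, v} \<in> L" for u v
  proof -
    have "card (nbrs L u \<inter> nbrs L v) \<le> card (nbrs E u \<inter> nbrs E v)"
      using \<open>L \<subseteq> E\<close> nbrs_subset[OF assms(2)] assms(1)
      by (intro card_mono) (auto simp: nbrs_def intro: finite_subset)
    also have "\<dots> = c {u, v}" by (simp add: c_def)
    finally show ?thesis using that unfolding L_def by simp
  qed
  then have "real (card L) - card \<F>
      \<le> (1 - 1 / real (l\<^sup>2 div 4)) * (card V * (card V + 3 * \<omega>) / 4)"
    using \<open>L \<subseteq> E\<close> assms(2) members covers
    by (intro edges_minus_cover_le_light assms(1,3,4,5)) auto
  moreover have "card E = card L + card (E - L)"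
    using fE \<open>L \<subseteq> E\<close> by (metis card_Diff_subset card_mono finite_subset le_add_diff_inverse)
  moreover have "card (E - L) \<le> real l ^ 3 * card \<F> / \<omega>" using heavy assms(5) by (simp add: field_simps)
  ultimately show ?thesis by linarith
qed

section \<open>Maximal antichains as covers\<close>

text \<open>Otherwise \<open>S\<close> could be added: its size is admissible, so only the antichain
  condition can fail.\<close>

lemma maximal_K_antichain_comparable:
  assumes "maximal_K_antichain K n \<A>" "S \<subseteq> {1..n}" "card S \<in> K" "S \<notin> \<A>"
  obtains B where "B \<in> \<A>" "B \<subset> S \<or> S \<subset> B"
proof -
  have K: "K_antichain K n \<A>" and "\<not> K_antichain K n (insert S \<A>)"
    using assms(1,4) unfolding maximal_K_antichain_def by blast+
  then have "\<not> antichain n (insert S \<A>)" using assms(3) by (simp add: K_antichain_def)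
  then have "\<exists>B\<in>\<A>. B \<subseteq> S \<or> S \<subseteq> B"
    using K assms(2) by (auto simp: K_antichain_def antichain_def)
  then show ?thesis using that assms(4) by (metis psubsetI)
qed

lemma antichain_edges_bound:
  assumes K: "finite K" "\<forall>k\<in>K. 2 \<le> k" "{2, 3} \<subseteq> K"
    and \<A>: "\<A> \<in> antichains_of_graph K n ({1..n}, E)" and "0 < n"
  shows "real (card E) - (\<Sum>k\<in>K - {2}. real (card (level \<A> k)))
    \<le> ((1 - 1 / real ((Max K)\<^sup>2 div 4)) / 4 + (1 + real (Max K) ^ 3) / sqrt n) * (real n)\<^sup>2"
proof -
  let ?l = "Max K" and ?V = "{1..n}"
  define \<F> where "\<F> = (\<Union>k\<in>K - {2}. level \<A> k)"
  have max: "maximal_K_antichain K n \<A>" and E: "E = [?V]\<^bsup>2\<^esup> - level \<A> 2"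
    using \<A> by (auto simp: antichains_of_graph_def assoc_graph_def)
  have sub: "\<A> \<subseteq> Pow ?V" and cardK: "\<And>A. A \<in> \<A> \<Longrightarrow> card A \<in> K"
    using max by (auto simp: maximal_K_antichain_def K_antichain_def antichain_def)
  have fA: "finite \<A>" using sub by (rule finite_subset) simp
  have finB: "finite B" if "B \<in> \<A>" for B
    using sub that by (meson PowD finite_atLeastAtMost finite_subset subsetD)
  have \<F>_iff: "B \<in> \<F> \<longleftrightarrow> B \<in> \<A> \<and> card B \<noteq> 2" for B
    using cardK by (auto simp: \<F>_def level_def)
  then have f\<F>: "finite \<F>" using fA by (auto intro: finite_subset)
  have "card \<F> = (\<Sum>k\<in>K - {2}. card (level \<A> k))"
    unfolding \<F>_def using K(1) fA by (intro card_UN_disjoint) (auto simp: level_def)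
  then have N: "(\<Sum>k\<in>K - {2}. real (card (level \<A> k))) = card \<F>" by simp
  have l3: "3 \<le> ?l" using K by simp
  have E2: "E \<subseteq> [?V]\<^bsup>2\<^esup>" using E by auto
  have members: "finite B \<and> card B \<le> ?l" if "B \<in> \<F>" for B
    using that \<F>_iff finB cardK K(1) by auto
  \<comment> \<open>An edge is a pair outside \<open>\<A>\<close>, hence comparable with some
    member. Members have at least two elements, so this one properly contains the edge.\<close>
  have covers: "\<exists>B\<in>\<F>. e \<subseteq> B" if e: "e \<in> E" for e
  proof -
    have e': "e \<subseteq> ?V" "card e = 2" "finite e" "e \<notin> \<A>" using e E by (auto simp: nsets_def level_def)
    then obtain B where B: "B \<in> \<A>" "B \<subset> e \<or> e \<subset> B"
      using maximal_K_antichain_comparable[OF max, of e] K(3) by auto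
    have "\<not> B \<subset> e"
      using psubset_card_mono[OF e'(3), of B] e'(2) K(2) cardK[OF B(1)] by (metis leD)
    then have "e \<subset> B" using B by auto
    then have "card B \<noteq> 2" using psubset_card_mono[OF finB[OF B(1)], of e] e'(2) by auto
    then show ?thesis using \<open>e \<subset> B\<close> B \<F>_iff by blast
  qed
  have covers3: "\<exists>B\<in>\<F>. {x, y, z} \<subseteq> B"
    if xyz: "{x, y} \<in> E" "{x, z} \<in> E" "{y, z} \<in> E" for x y z
  proof (cases "{x, y, z} \<in> \<A>")
    case True
    have "x \<noteq> y" "x \<noteq> z" "y \<noteq> z" using xyz E2 by (auto simp: nsets_def)
    then show ?thesis using True \<F>_iff by (intro bexI[of _ "{x, y, z}"]) auto
  next
    case False
    have ne: "x \<noteq> y" "x \<noteq> z" "y \<noteq> z" using xyz E2 by (auto simp: nsets_def)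
    then have c: "card {x, y, z} = 3" by simp
    have "{x, y, z} \<subseteq> ?V" using xyz E2 by (auto simp: nsets_def)
    then obtain B where B: "B \<in> \<A>" "B \<subset> {x, y, z} \<or> {x, y, z} \<subset> B"
      using maximal_K_antichain_comparable[OF max, of "{x, y, z}"] K(3) c False by auto
    \<comment> \<open>Such a member would have exactly two elements and be a side of the triangle;
      but the sides are edges, and no edge belongs to \<open>\<A>\<close>.\<close>
    have "\<not> B \<subset> {x, y, z}"
    proof
      assume B': "B \<subset> {x, y, z}"
      then have "card B < 3" using psubset_card_mono[of "{x, y, z}" B] c by simp
      then have B2: "card B = 2" using K(2) cardK[OF B(1)] by (simp add: order_antisym)
      then obtain a b where "B = {a, b}" "a \<noteq> b" by (auto simp: card_2_iff)
      moreover have "{y, x} \<in> E" "{z, x} \<in> E" "{z, y} \<in> E" using xyz by (simp_all add: insert_commute)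
      ultimately have "B \<in> E" using B' xyz by auto
      then show False using E B(1) B2 by (simp add: level_def)
    qed
    then have s: "{x, y, z} \<subset> B" using B by auto
    then have "card B \<noteq> 2" using psubset_card_mono[OF finB[OF B(1)] s] c by simp
    then show ?thesis using s B \<F>_iff by blast
  qed
  have "2 \<le> ?l\<^sup>2 div 4" using l3 by (rule two_le_square_div_4)
  then have m2: "2 \<le> real (?l\<^sup>2 div 4)" by linarith
  define a where "a = 1 - 1 / real (?l\<^sup>2 div 4)"
  have a: "0 \<le> a" "a \<le> 1" using m2 by (auto simp: a_def)
  show ?thesis
  \<comment> \<open>In the first case the left side is not positive. In the second,
    \<open>card \<F>\<close> is smaller than \<open>card E\<close>, hence at most
    \<open>n\<^sup>2\<close>, which controls the error from heavy edges.\<close>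
  proof (cases "card E \<le> card \<F>")
    case True
    then have "real (card E) - card \<F> \<le> 0" by simp
    also have "0 \<le> (a / 4 + (1 + real ?l ^ 3) / sqrt n) * (real n)\<^sup>2" using a by simp
    finally show ?thesis unfolding N a_def .
  next
    case False
    have "card E \<le> card ([?V]\<^bsup>2\<^esup>)" using E2 by (intro card_mono finite_imp_finite_nsets) auto
    also have "\<dots> \<le> n\<^sup>2"
      by (cases "2 \<le> n") (auto simp: card_nsets binomial_eq_0 intro: binomial_le_pow)
    finally have "card \<F> \<le> n\<^sup>2" using False by linarith
    then have Nn: "real (card \<F>) \<le> (real n)\<^sup>2" by (metis of_nat_le_iff of_nat_power)
    \<comment> \<open>This is \<open>\<omega>\<close>. It balances the two errors: the slack in the
      neighbourhoods (\<open>n * s\<close>) and the heavy edges (\<open>n\<^sup>2 / s\<close>) are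
      both of order \<open>s ^ 3\<close>.\<close>
    define s where "s = sqrt n"
    have s: "0 < s" "real n = s * s" using \<open>0 < n\<close> by (auto simp: s_def)
    have "real (card E) - card \<F> \<le> a * (n * (n + 3 * s) / 4) + real ?l ^ 3 * card \<F> / s"
      using edges_minus_cover_le[OF _ E2 f\<F> l3 s(1) members covers covers3]
      by (simp add: a_def)
    also have "\<dots> \<le> a * (n * (n + 3 * s) / 4) + real ?l ^ 3 * (real n)\<^sup>2 / s"
      using Nn s(1) by (intro add_left_mono divide_right_mono mult_left_mono) auto
    also have "a * (n * (n + 3 * s) / 4) = a / 4 * (real n)\<^sup>2 + a * (3 / 4) * s ^ 3"
      unfolding s(2) by (simp add: power2_eq_square power3_eq_cube field_simps)
    also have "a * (3 / 4) * s ^ 3 \<le> 1 * s ^ 3" using a s by (intro mult_right_mono) auto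
    also have "s ^ 3 = (real n)\<^sup>2 / s"
      unfolding s(2) using s(1) by (simp add: power2_eq_square power3_eq_cube)
    finally have "real (card E) - card \<F> \<le> (a / 4 + (1 + real ?l ^ 3) / s) * (real n)\<^sup>2"
      by (simp add: algebra_simps add_divide_distrib)
    then show ?thesis unfolding N a_def s_def .
  qed
qed

section \<open>The constant and the error term\<close>

text \<open>Identifies the product in the stated constant with the Mantel bound: both are
  \<open>k * k\<close> for \<open>l = 2 * k\<close> and \<open>k * (k + 1)\<close> for
  \<open>l = 2 * k + 1\<close>.\<close>

lemma floor_half_times_ceiling_half:
  "\<lfloor>real l / 2\<rfloor> * \<lceil>real l / 2\<rceil> = int (l\<^sup>2 div 4)"
proof (cases "even l")
  case True
  then obtain k where "l = 2 * k" by (elim evenE)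
  then show ?thesis by (simp add: power2_eq_square)
next
  case False
  then obtain k where k: "l = 2 * k + 1" by (elim oddE)
  have "\<lfloor>real l / 2\<rfloor> = int k" "\<lceil>real l / 2\<rceil> = int k + 1"
    by (simp_all add: k floor_eq_iff ceiling_eq_iff field_simps)
  moreover have "l\<^sup>2 = 4 * (k * (k + 1)) + 1" by (simp add: k power2_eq_square algebra_simps)
  then have "l\<^sup>2 div 4 = k * (k + 1)" by presburger
  ultimately show ?thesis by (simp add: algebra_simps)
qed

theorem theorem6:
  fixes K :: "nat set" and l :: nat
  assumes "finite K" and "\<forall>k\<in>K. 2 \<le> k" and "{2, 3} \<subseteq> K" and "l = Max K"
  shows "\<exists>\<epsilon> :: nat \<Rightarrow> real. \<epsilon> \<longlonglongrightarrow> 0 \<and>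
    (\<forall>n. K \<subseteq> {1..n} \<longrightarrow>
      (\<forall>V E. V = {1..n} \<and> simple_graph (V, E) \<and> saturated K (V, E) \<longrightarrow>
        (\<forall>\<A> \<in> antichains_of_graph K n (V, E).
          real (card E) - (\<Sum>k\<in>K - {2}. real (card (level \<A> k)))
            \<le> ((of_int (\<lfloor>real l / 2\<rfloor> * \<lceil>real l / 2\<rceil>) - 1)
                 / (4 * of_int (\<lfloor>real l / 2\<rfloor> * \<lceil>real l / 2\<rceil>)) + \<epsilon> n) * (real n)\<^sup>2)) \<and>
      ((of_int (\<lfloor>real l / 2\<rfloor> * \<lceil>real l / 2\<rceil>) - 1)
          / (4 * of_int (\<lfloor>real l / 2\<rfloor> * \<lceil>real l / 2\<rceil>)) + \<epsilon> n) * (real n)\<^sup>2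
        = (if even l then (((real l)\<^sup>2 - 4) / (4 * (real l)\<^sup>2) + \<epsilon> n) * (real n)\<^sup>2
           else (((real l)\<^sup>2 - 5) / (4 * (real l)\<^sup>2 - 4) + \<epsilon> n) * (real n)\<^sup>2))"
proof -
  \<comment> \<open>Depends only on \<open>n\<close> and \<open>l = Max K\<close>, so it serves all
    graphs and antichains at once.\<close>
  define \<epsilon> :: "nat \<Rightarrow> real" where "\<epsilon> n = (1 + real l ^ 3) / sqrt n" for n
  let ?m = "l\<^sup>2 div 4"
  have l3: "3 \<le> l" using assms by simp
  then have m2: "2 \<le> ?m" by (rule two_le_square_div_4)
  have frac: "(of_int (\<lfloor>real l / 2\<rfloor> * \<lceil>real l / 2\<rceil>) - 1)
      / (4 * of_int (\<lfloor>real l / 2\<rfloor> * \<lceil>real l / 2\<rceil>)) = (1 - 1 / real ?m) / 4"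
    unfolding floor_half_times_ceiling_half using m2 by (simp add: field_simps)
  have closed_form: "(1 - 1 / real ?m) / 4
    = (if even l then ((real l)\<^sup>2 - 4) / (4 * (real l)\<^sup>2) else ((real l)\<^sup>2 - 5) / (4 * (real l)\<^sup>2 - 4))"
  proof (cases "even l")
    case True
    then obtain k where "l = 2 * k" by (elim evenE)
    with l3 show ?thesis by (simp add: power2_eq_square field_simps)
  next
    case False
    then obtain k where k: "l = 2 * k + 1" by (elim oddE)
    have sq: "l\<^sup>2 = 4 * (k * (k + 1)) + 1" by (simp add: k power2_eq_square algebra_simps)
    \<comment> \<open>In terms of \<open>t\<close> the numerator \<open>l\<^sup>2 - 5\<close> is
      \<open>4 * (t - 1)\<close> and the denominator \<open>4 * l\<^sup>2 - 4\<close> is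
      \<open>16 * t\<close>.\<close>
    define t where "t = real (k * (k + 1))"
    have "(real l)\<^sup>2 = 4 * t + 1" using arg_cong[OF sq, of real] by (simp add: t_def)
    moreover have "?m = k * (k + 1)" using sq by presburger
    then have "real ?m = t" by (simp only: t_def)
    moreover have "t > 0" using k l3 by (auto simp: t_def simp del: of_nat_mult)
    ultimately show ?thesis using False by (simp add: field_simps)
  qed
  have "\<epsilon> \<longlonglongrightarrow> 0"
    unfolding \<epsilon>_def
    by (intro tendsto_divide_0[OF tendsto_const] filterlim_at_top_imp_at_infinity
        filterlim_compose[OF sqrt_at_top filterlim_real_sequentially])
  moreover have "real (card E) - (\<Sum>k\<in>K - {2}. real (card (level \<A> k)))
      \<le> ((1 - 1 / real ?m) / 4 + \<epsilon> n) * (real n)\<^sup>2"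
    if "K \<subseteq> {1..n}" "\<A> \<in> antichains_of_graph K n ({1..n}, E)" for n E \<A>
  proof -
    have "0 < n" using that(1) assms(3) by (cases n) auto
    then show ?thesis
      unfolding \<epsilon>_def assms(4) by (rule antichain_edges_bound[OF assms(1-3) that(2)])
  qed
  ultimately show ?thesis
    unfolding frac by (intro exI[of _ \<epsilon>]) (auto simp: closed_form)
qed

end
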